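(* Let $\mathcal{A}$ be a set and let $D_a$ be a set for each $a\in\mathcal{A}$. Let $L$ be the lattice of finite subsets of $\mathcal{A}$ ordered by inclusion. Let $\mathcal{R}:L^{\mathrm{op}}\to\mathbf{Set}$ be the presheaf sending $A\in L$ to the set of all $A$-relations, i.e. subsets $T_A\subseteq\prod_{a\in A}D_a$, with restriction along $A'\subseteq A$ sending $T_A$ to its image under the projection $\prod_{a\in A}D_a\to\prod_{a\in A'}D_a$. For $A,B\in L$ define $g_{A,B}:\mathcal{R}(A)\times_{\mathcal{R}(A\cap B)}\mathcal{R}(B)\to\mathcal{R}(A\cup B)$ by $$g_{A,B}(T_A,T_B):=\Big\{r\in\prod_{a\in A\cup B}D_a\ \Big|\ r|_A\in T_A,\ r|_B\in T_B\Big\}.$$ Then $(\mathcal{R},g)$ is a gleaf on $L$.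
   Context: A gleaf on a distributive lattice $L$ (with order $\subseteq$, meet $\cap$, join $\cup$) is a presheaf $\Gamma:L^{\mathrm{op}}\to\mathbf{Set}$ together with a map $g_{U,V}:\Gamma(U)\times_{\Gamma(U\cap V)}\Gamma(V)\to\Gamma(U\cup V)$ for every unordered pair $U,V\in L$ (so $g_{U,V}$ and $g_{V,U}$ agree up to swapping arguments), such that: 1. if $V\subseteq U$, then $g_{U,V}(\alpha,\alpha|_V)=\alpha$ for all $\alpha\in\Gamma(U)$; 2. for $U',U,V\in L$ with $U'\subseteq U$ and $U'\cup V=U\cup V$, the composite $\Gamma(U')\times_{\Gamma(U'\cap V)}\Gamma(V)\xrightarrow{g_{U',V}}\Gamma(U\cup V)\to\Gamma(U)\times_{\Gamma(U\cap V)}\Gamma(V)\xrightarrow{g_{U,V}}\Gamma(U\cup V)$ (middle arrow: restriction) equals $g_{U',V}$; 3. for $U',U,V\in L$ with $U'\subseteq U$ and $U'\cap V=U\cap V$, one has $g_{U,V}(\alpha,\beta)|_{U'\cup V}=g_{U',V}(\alpha|_{U'},\beta)$ for all $(\alpha,\beta)\in\Gamma(U)\times_{\Gamma(U\cap V)}\Gamma(V)$. *)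

theory Defs
  imports "HOL-Algebra.Lattice" "HOL-Library.FuncSet"
begin

locale distributive_lattice = lattice L for L (structure) +
  assumes meet_join_distrib:
    "\<lbrakk>x \<in> carrier L; y \<in> carrier L; z \<in> carrier L\<rbrakk> \<Longrightarrow>
      x \<sqinter> (y \<squnion> z) = (x \<sqinter> y) \<squnion> (x \<sqinter> z)"

text \<open>A set-valued presheaf on a poset. The sets \<open>\<Gamma> U\<close> all live in one common type but need not
  be disjoint, so a restriction map carries both its source and its target:
  for \<open>V\<close> below \<open>U\<close>, \<open>res U V\<close> is the map from \<open>\<Gamma> U\<close> to \<open>\<Gamma> V\<close>.\<close>

locale presheaf = partial_order L for L (structure) +
  fixes \<Gamma> :: "'a \<Rightarrow> 's set"
    and res :: "'a \<Rightarrow> 'a \<Rightarrow> 's \<Rightarrow> 's"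
  assumes res_closed:
      "\<lbrakk>U \<in> carrier L; V \<in> carrier L; V \<sqsubseteq> U; \<alpha> \<in> \<Gamma> U\<rbrakk> \<Longrightarrow> res U V \<alpha> \<in> \<Gamma> V"
    and res_id:
      "\<lbrakk>U \<in> carrier L; \<alpha> \<in> \<Gamma> U\<rbrakk> \<Longrightarrow> res U U \<alpha> = \<alpha>"
    and res_comp:
      "\<lbrakk>U \<in> carrier L; V \<in> carrier L; W \<in> carrier L; W \<sqsubseteq> V; V \<sqsubseteq> U; \<alpha> \<in> \<Gamma> U\<rbrakk> \<Longrightarrow>
        res V W (res U V \<alpha>) = res U W \<alpha>"

definition fiber_product ::
  "('a, 'm) gorder_scheme \<Rightarrow> ('a \<Rightarrow> 's set) \<Rightarrow> ('a \<Rightarrow> 'a \<Rightarrow> 's \<Rightarrow> 's) \<Rightarrow> 'a \<Rightarrow> 'a \<Rightarrow> ('s \<times> 's) set"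
  where "fiber_product L \<Gamma> res U V =
    {(\<alpha>, \<beta>) \<in> \<Gamma> U \<times> \<Gamma> V. res U (U \<sqinter>\<^bsub>L\<^esub> V) \<alpha> = res V (U \<sqinter>\<^bsub>L\<^esub> V) \<beta>}"

text \<open>In \<open>glue_extend\<close> the pair of restrictions of \<open>\<gamma>\<close> lies in the fiber product over
  \<open>U \<sqinter> V\<close> by functoriality, and \<open>\<gamma>\<close> has domain \<open>U \<squnion> V\<close> because \<open>U' \<squnion> V = U \<squnion> V\<close>;
  in \<open>glue_restrict\<close> the pair \<open>(res U U' \<alpha>, \<beta>)\<close> is compatible because \<open>U' \<sqinter> V = U \<sqinter> V\<close>.
  The family \<open>g\<close> is indexed by ordered pairs; \<open>glue_sym\<close> makes it a family over
  unordered ones.\<close>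

locale gleaf = distributive_lattice L + presheaf L \<Gamma> res
  for L (structure)
    and \<Gamma> :: "'a \<Rightarrow> 's set"
    and res :: "'a \<Rightarrow> 'a \<Rightarrow> 's \<Rightarrow> 's" +
  fixes g :: "'a \<Rightarrow> 'a \<Rightarrow> 's \<times> 's \<Rightarrow> 's"
  assumes glue_closed:
      "\<lbrakk>U \<in> carrier L; V \<in> carrier L\<rbrakk> \<Longrightarrow> g U V \<in> fiber_product L \<Gamma> res U V \<rightarrow> \<Gamma> (U \<squnion> V)"
    and glue_sym:
      "\<lbrakk>U \<in> carrier L; V \<in> carrier L; (\<alpha>, \<beta>) \<in> fiber_product L \<Gamma> res U V\<rbrakk> \<Longrightarrow>
        g U V (\<alpha>, \<beta>) = g V U (\<beta>, \<alpha>)"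
    and glue_absorb:
      "\<lbrakk>U \<in> carrier L; V \<in> carrier L; V \<sqsubseteq> U; \<alpha> \<in> \<Gamma> U\<rbrakk> \<Longrightarrow> g U V (\<alpha>, res U V \<alpha>) = \<alpha>"
    and glue_extend:
      "\<lbrakk>U' \<in> carrier L; U \<in> carrier L; V \<in> carrier L; U' \<sqsubseteq> U; U' \<squnion> V = U \<squnion> V;
        (\<alpha>, \<beta>) \<in> fiber_product L \<Gamma> res U' V; \<gamma> = g U' V (\<alpha>, \<beta>)\<rbrakk> \<Longrightarrow>
        g U V (res (U \<squnion> V) U \<gamma>, res (U \<squnion> V) V \<gamma>) = \<gamma>"
    and glue_restrict:
      "\<lbrakk>U' \<in> carrier L; U \<in> carrier L; V \<in> carrier L; U' \<sqsubseteq> U; U' \<sqinter> V = U \<sqinter> V;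
        (\<alpha>, \<beta>) \<in> fiber_product L \<Gamma> res U V\<rbrakk> \<Longrightarrow>
        res (U \<squnion> V) (U' \<squnion> V) (g U V (\<alpha>, \<beta>)) = g U' V (res U U' \<alpha>, \<beta>)"

definition finite_subsets :: "'i set \<Rightarrow> 'i set gorder"
  where "finite_subsets \<A> = \<lparr>carrier = Fpow \<A>, eq = (=), le = (\<subseteq>)\<rparr>"

definition relations :: "('i \<Rightarrow> 'd set) \<Rightarrow> 'i set \<Rightarrow> ('i \<Rightarrow> 'd) set set"
  where "relations D A = Pow (\<Pi>\<^sub>E a\<in>A. D a)"

text \<open>The projection does not refer to the source \<open>A\<close>; the argument is kept so that the
  map fits the shape \<open>res U V\<close>.\<close>

definition project ::
  "'i set \<Rightarrow> 'i set \<Rightarrow> ('i \<Rightarrow> 'd) set \<Rightarrow> ('i \<Rightarrow> 'd) set"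
  where "project A A' T = (\<lambda>r. restrict r A') ` T"

definition rel_join ::
  "('i \<Rightarrow> 'd set) \<Rightarrow> 'i set \<Rightarrow> 'i set \<Rightarrow> ('i \<Rightarrow> 'd) set \<times> ('i \<Rightarrow> 'd) set \<Rightarrow> ('i \<Rightarrow> 'd) set"
  where "rel_join D A B = (\<lambda>(S, T).
    {r \<in> \<Pi>\<^sub>E a\<in>A \<union> B. D a. restrict r A \<in> S \<and> restrict r B \<in> T})"

end

theory Submission
  imports Defs
begin

text \<open>
  A relation on \<open>A\<close> is a set of records with attributes \<open>A\<close>, and \<open>rel_join\<close> is the natural join:
  a record belongs to it if and only if its restrictions to \<open>A\<close> and \<open>B\<close> pass the two membership
  tests. Extension (\<open>rel_join_projections\<close>) holds because the test on \<open>A' \<subseteq> A\<close> only sees the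
  restriction to \<open>A\<close>: a record on \<open>A \<union> B\<close> whose restriction to \<open>A\<close> is that of a member of the join
  over \<open>A'\<close> and \<open>B\<close> passes the test on \<open>A'\<close>, and likewise for \<open>B\<close>.

  Restriction (\<open>project_rel_join\<close>) is the only axiom for which a record has to be constructed. Let
  \<open>r\<close> be a record on \<open>A' \<union> B\<close> whose restriction to \<open>A'\<close> extends to some \<open>s \<in> S\<close> on \<open>A\<close>. The domains
  of \<open>s\<close> and \<open>r\<close> overlap in \<open>A \<inter> (A' \<union> B) = A' \<union> (A \<inter> B)\<close>. If \<open>A' \<inter> B = A \<inter> B\<close>, this overlap is just
  \<open>A'\<close>, where \<open>s\<close> and \<open>r\<close> agree. They can therefore be pasted to one record on \<open>A \<union> B\<close>, which lies
  in the join of \<open>S\<close> and \<open>T\<close> and restricts to \<open>r\<close>.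

  The lattice operations of \<open>finite_subsets\<close> are given as least upper and greatest lower bounds;
  identifying them with union and intersection gives distributivity and turns the axioms into
  statements about sets of attributes.
\<close>

section \<open>The lattice of finite subsets\<close>

lemma finite_subsets_simps [simp]:
  "carrier (finite_subsets \<A>) = Fpow \<A>"
  "le (finite_subsets \<A>) = (\<subseteq>)"
  "eq (finite_subsets \<A>) = (=)"
  by (simp_all add: finite_subsets_def)

lemma partial_order_finite_subsets: "partial_order (finite_subsets \<A>)"
  by unfold_locales auto

lemma least_Upper_finite_subsets:
  assumes "A \<in> Fpow \<A>" "B \<in> Fpow \<A>"
  shows "least (finite_subsets \<A>) (A \<union> B) (Upper (finite_subsets \<A>) {A, B})"
  using assms by (auto simp: least_def Upper_def Fpow_def)

lemma greatest_Lower_finite_subsets: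
  assumes "A \<in> Fpow \<A>" "B \<in> Fpow \<A>"
  shows "greatest (finite_subsets \<A>) (A \<inter> B) (Lower (finite_subsets \<A>) {A, B})"
  using assms by (auto simp: greatest_def Lower_def Fpow_def)

lemma lattice_finite_subsets: "lattice (finite_subsets \<A>)"
proof -
  interpret partial_order "finite_subsets \<A>"
    by (rule partial_order_finite_subsets)
  show ?thesis
    by unfold_locales
      (use least_Upper_finite_subsets greatest_Lower_finite_subsets in fastforce)+
qed

lemma join_finite_subsets:
  assumes "A \<in> Fpow \<A>" "B \<in> Fpow \<A>"
  shows "A \<squnion>\<^bsub>finite_subsets \<A>\<^esub> B = A \<union> B"
proof -
  interpret lattice "finite_subsets \<A>"
    by (rule lattice_finite_subsets)
  show ?thesis
    using least_unique [OF least_Upper_finite_subsets [OF assms]] sup_of_two_least assms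
    by (metis finite_subsets_simps(1) join_def)
qed

lemma meet_finite_subsets:
  assumes "A \<in> Fpow \<A>" "B \<in> Fpow \<A>"
  shows "A \<sqinter>\<^bsub>finite_subsets \<A>\<^esub> B = A \<inter> B"
proof -
  interpret lattice "finite_subsets \<A>"
    by (rule lattice_finite_subsets)
  show ?thesis
    using greatest_unique [OF greatest_Lower_finite_subsets [OF assms]] inf_of_two_greatest assms
    by (metis finite_subsets_simps(1) meet_def)
qed

lemma distributive_lattice_finite_subsets: "distributive_lattice (finite_subsets \<A>)"
proof -
  interpret lattice "finite_subsets \<A>"
    by (rule lattice_finite_subsets)
  have "A \<union> B \<in> Fpow \<A>" "A \<inter> B \<in> Fpow \<A>" if "A \<in> Fpow \<A>" "B \<in> Fpow \<A>" for A B
    using that by (auto simp: Fpow_def)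
  then show ?thesis
    by unfold_locales (simp add: join_finite_subsets meet_finite_subsets Int_Un_distrib)
qed


section \<open>Relations and their projections\<close>

lemma project_in_relations:
  assumes "B \<subseteq> A" "T \<in> relations D A"
  shows "project A B T \<in> relations D B"
  using assms by (fastforce simp: relations_def project_def PiE_iff)

lemma project_self:
  assumes "T \<in> relations D A"
  shows "project A A T = T"
proof -
  have "restrict r A = r" if "r \<in> T" for r
    using that assms by (auto simp: relations_def intro: PiE_restrict)
  then show ?thesis
    by (simp add: project_def)
qed

lemma project_project:
  assumes "C \<subseteq> B"
  shows "project B C (project A B T) = project A C T"
  using assms by (simp add: project_def image_image Int_absorb1)

lemma presheaf_relations: "presheaf (finite_subsets \<A>) (relations D) project"
proof -
  interpret partial_order "finite_subsets \<A>"
    by (rule partial_order_finite_subsets)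
  show ?thesis
    by unfold_locales (simp_all add: project_in_relations project_self project_project)
qed


section \<open>The natural join\<close>

lemma mem_rel_join:
  "r \<in> rel_join D A B (S, T) \<longleftrightarrow>
    r \<in> (\<Pi>\<^sub>E a\<in>A \<union> B. D a) \<and> restrict r A \<in> S \<and> restrict r B \<in> T"
  by (simp add: rel_join_def)

lemma rel_join_in_relations: "rel_join D A B (S, T) \<in> relations D (A \<union> B)"
  by (auto simp: relations_def mem_rel_join)

lemma rel_join_commute: "rel_join D A B (S, T) = rel_join D B A (T, S)"
  by (auto simp: mem_rel_join Un_commute)

lemma rel_join_project_absorb:
  assumes "B \<subseteq> A" "S \<in> relations D A"
  shows "rel_join D A B (S, project A B S) = S"
proof -
  have "restrict r A = r" if "r \<in> (\<Pi>\<^sub>E a\<in>A. D a)" for r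
    using that by (rule PiE_restrict)
  moreover have "A \<union> B = A"
    using assms(1) by blast
  ultimately show ?thesis
    using assms(2) by (auto simp: mem_rel_join relations_def project_def)
qed

text \<open>The witnesses \<open>s\<close> and \<open>t\<close> for the restrictions of \<open>r\<close> to \<open>A\<close> and to \<open>B\<close> may be different members
  of the join. This does no harm, because one is used only on \<open>A'\<close> and the other only on \<open>B\<close>.\<close>

lemma rel_join_projections:
  assumes "A' \<subseteq> A" "A' \<union> B = A \<union> B"
  shows "rel_join D A B (project (A \<union> B) A (rel_join D A' B (S, T)),
      project (A \<union> B) B (rel_join D A' B (S, T))) = rel_join D A' B (S, T)"
    (is "?l = ?J")
proof
  show "?l \<subseteq> ?J"
  proof
    fix r assume "r \<in> ?l"
    then obtain s t where r: "r \<in> (\<Pi>\<^sub>E a\<in>A \<union> B. D a)"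
      and s: "s \<in> ?J" "restrict r A = restrict s A"
      and t: "t \<in> ?J" "restrict r B = restrict t B"
      by (auto simp: mem_rel_join project_def)
    have "restrict r A' = restrict s A'"
      using s(2) assms(1) by (metis Int_absorb1 restrict_restrict)
    with r s(1) t show "r \<in> ?J"
      by (simp add: mem_rel_join assms(2))
  qed
  show "?J \<subseteq> ?l"
    by (auto simp: mem_rel_join project_def assms(2))
qed

text \<open>For the inclusion from right to left, a lift \<open>s \<in> S\<close> of the restriction of \<open>r\<close> to \<open>A'\<close> is pasted
  with \<open>r\<close>. Equality of the intersections keeps \<open>s\<close> from interfering with \<open>r\<close> on \<open>B\<close> outside \<open>A'\<close>.\<close>

lemma project_rel_join:
  assumes "A' \<subseteq> A" "A' \<inter> B = A \<inter> B" "S \<in> relations D A"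
  shows "project (A \<union> B) (A' \<union> B) (rel_join D A B (S, T)) = rel_join D A' B (project A A' S, T)"
    (is "?l = ?r")
proof
  show "?l \<subseteq> ?r"
  proof
    fix r assume "r \<in> ?l"
    then obtain t where t: "t \<in> rel_join D A B (S, T)" and r: "r = restrict t (A' \<union> B)"
      by (auto simp: project_def)
    have "restrict r A' = restrict (restrict t A) A'" "restrict r B = restrict t B"
      using assms(1) by (auto simp: r Int_absorb1 Int_absorb2)
    moreover from this(1) have "restrict r A' \<in> project A A' S"
      using t unfolding project_def mem_rel_join by blast
    moreover have "r \<in> (\<Pi>\<^sub>E a\<in>A' \<union> B. D a)"
      using t assms(1) by (auto simp: r mem_rel_join PiE_iff)
    ultimately show "r \<in> ?r"
      using t by (simp add: mem_rel_join)
  qed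
  show "?r \<subseteq> ?l"
  proof
    fix r assume "r \<in> ?r"
    then obtain s where r: "r \<in> (\<Pi>\<^sub>E a\<in>A' \<union> B. D a)" "restrict r B \<in> T"
      and s: "s \<in> S" "restrict r A' = restrict s A'"
      by (auto simp: mem_rel_join project_def)
    have s_PiE: "s \<in> (\<Pi>\<^sub>E a\<in>A. D a)"
      using s(1) assms(3) by (auto simp: relations_def)
    have agree: "r a = s a" if "a \<in> A'" for a
      using s(2) that by (metis restrict_apply')
    define t where "t = (\<lambda>a. if a \<in> A then s a else r a)"
    have t_s: "restrict t A = s"
      using s_PiE by (auto simp: t_def PiE_iff extensional_def)
    have "A \<inter> (A' \<union> B) = A'"
      using assms(1,2) by blast
    then have t_r: "t a = r a" if "a \<in> A' \<union> B" for a
      using that agree unfolding t_def by (metis IntI)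
    have "restrict t B = restrict r B"
      using t_r by (auto simp: restrict_def)
    moreover have "t \<in> (\<Pi>\<^sub>E a\<in>A \<union> B. D a)"
      using s_PiE r(1) assms(1) by (auto simp: t_def PiE_iff extensional_def)
    ultimately have "t \<in> rel_join D A B (S, T)"
      using t_s s(1) r(2) by (simp add: mem_rel_join)
    moreover have "restrict t (A' \<union> B) = r"
      using r(1) t_r by (auto simp: PiE_iff extensional_def restrict_def)
    ultimately show "r \<in> ?l"
      by (auto simp: project_def)
  qed
qed


section \<open>The gleaf of relations\<close>

theorem proposition5p3p1:
  fixes \<A> :: "'i set" and D :: "'i \<Rightarrow> 'd set"
  shows "gleaf (finite_subsets \<A>) (relations D) project (rel_join D)"
proof -
  interpret distributive_lattice "finite_subsets \<A>"
    by (rule distributive_lattice_finite_subsets)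
  interpret presheaf "finite_subsets \<A>" "relations D" project
    by (rule presheaf_relations)
  show ?thesis
  proof (unfold_locales, goal_cases)
    case (1 U V)
    then show ?case
      by (auto simp: join_finite_subsets rel_join_in_relations)
  next
    case (2 U V S T)
    show ?case
      by (rule rel_join_commute)
  next
    case (3 U V S)
    then show ?case
      by (simp add: rel_join_project_absorb)
  next
    case (4 U' U V S T R)
    then show ?case
      by (simp add: join_finite_subsets rel_join_projections)
  next
    case (5 U' U V S T)
    then show ?case
      by (simp add: join_finite_subsets meet_finite_subsets fiber_product_def project_rel_join)
  qed
qed

end
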